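(* Let $N\ge 5$ be prime. Suppose $\mathbf{H}=\sum_{i=0}^{N^2-1}s_i\mathbf{H}_i\in\mathbb{C}^{N\times N}$, where the coefficient vector $\mathbf{s}=(s_0,\dots,s_{N^2-1})^{\mathrm T}\in\mathbb{C}^{N^2}$ is $K$-sparse with $K<\tfrac12(\sqrt N+1)$, and suppose that $\mathbf{y}=\mathbf{H}\mathbf{f}$ is observed, where $\mathbf{f}$ is the Alltop sequence of length $N$. Then $\mathbf{s}$ is guaranteed to be recovered from $\mathbf{y}$ by either method, Basis Pursuit or Orthogonal Matching Pursuit. That is: (i) $\mathbf{s}$ is the unique minimizer of $\|\mathbf{s}'\|_1$ over all $\mathbf{s}'\in\mathbb{C}^{N^2}$ with $\mathbf{\Phi}\mathbf{s}'=\mathbf{y}$; and (ii) Orthogonal Matching Pursuit applied to $(\mathbf{\Phi},\mathbf{y})$ outputs $\mathbf{s}$.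
   Context: Indices of coordinates in $\mathbb{C}^N$ run over $0,\dots,N-1$, and $\omega_N=e^{2\pi \mathrm{i}/N}$, with $\mathrm{i}=\sqrt{-1}$. Time-frequency basis: $\mathbf{S}$ is the $N\times N$ cyclic unit-shift matrix, $\mathbf{S}e_j=e_{(j+1)\bmod N}$ on standard basis vectors, and $\mathbf{M}=\mathrm{diag}(\omega_N^0,\omega_N^1,\dots,\omega_N^{N-1})$. For $i=0,\dots,N^2-1$, $\mathbf{H}_i=\mathbf{M}^{\,i \bmod N}\,\mathbf{S}^{\lfloor i/N\rfloor}$. The unitary matrices $\mathbf{H}_i$ form a basis of $\mathbb{C}^{N\times N}$, orthogonal for the Frobenius inner product. Alltop sequence: $\mathbf{f}=(f_n)_{n=0}^{N-1}$ with $f_n=\frac{1}{\sqrt N}e^{2\pi \mathrm{i} n^3/N}$. Dictionary: $\mathbf{\Phi}\in\mathbb{C}^{N\times N^2}$ is the matrix with columns (atoms) $\boldsymbol{\varphi}_i=\mathbf{H}_i\mathbf{f}$, $i=0,\dots,N^2-1$, so that $\mathbf{H}\mathbf{f}=\mathbf{\Phi}\mathbf{s}$. A vector is $K$-sparse if at most $K$ of its entries are nonzero. $\|\mathbf{s}'\|_1=\sum_i|s'_i|$. Basis Pursuit (BP): solve $\min\|\mathbf{s}'\|_1$ subject to $\mathbf{\Phi}\mathbf{s}'=\mathbf{y}$. Orthogonal Matching Pursuit (OMP): start with residual $\mathbf{r}_0=\mathbf{y}$ and index set $\Lambda_0=\emptyset$. At step $t\ge1$, as long as $t\le K$ and $\mathbf{r}_{t-1}\neq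 0$, choose an index $\lambda_t$ maximizing $|\langle\mathbf{r}_{t-1},\boldsymbol{\varphi}_i\rangle|$ over all $i$ (ties broken arbitrarily), set $\Lambda_t=\Lambda_{t-1}\cup\{\lambda_t\}$, let $\mathbf{s}_t$ be a vector supported on $\Lambda_t$ minimizing $\|\mathbf{y}-\mathbf{\Phi}\mathbf{s}'\|_2$ over vectors $\mathbf{s}'$ supported on $\Lambda_t$, and set $\mathbf{r}_t=\mathbf{y}-\mathbf{\Phi}\mathbf{s}_t$. The output is the last $\mathbf{s}_t$ computed (with $\mathbf{s}_0=0$). *)

theory Defs
  imports
    "HOL-Analysis.L2_Norm"
    "HOL-Computational_Algebra.Primes"
    "Jordan_Normal_Form.Matrix"
    "Jordan_Normal_Form.Conjugate"
begin

definition root_of_unity :: "nat \<Rightarrow> complex" where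
  "root_of_unity N = exp (2 * of_real pi * \<i> / of_nat N)"

text \<open>Column \<open>j\<close> is the unit vector with index \<open>(j + 1) mod N\<close>.\<close>

definition shift_mat :: "nat \<Rightarrow> complex mat" where
  "shift_mat N = mat N N (\<lambda>(i, j). if i = (j + 1) mod N then 1 else 0)"

definition modulation_mat :: "nat \<Rightarrow> complex mat" where
  "modulation_mat N = mat_diag N (\<lambda>k. root_of_unity N ^ k)"

definition tf_basis :: "nat \<Rightarrow> nat \<Rightarrow> complex mat" where
  "tf_basis N i = (modulation_mat N ^\<^sub>m (i mod N)) * (shift_mat N ^\<^sub>m (i div N))"

text \<open>The sum of the matrices \<open>s $ i \<cdot>\<^sub>m tf_basis N i\<close> over \<open>i < N\<^sup>2\<close>, written entrywise
  because matrices of varying dimension have no type-class addition with a zero.\<close>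

definition tf_matrix :: "nat \<Rightarrow> complex vec \<Rightarrow> complex mat" where
  "tf_matrix N s = mat N N (\<lambda>(a, b). \<Sum>i<N\<^sup>2. (s $ i \<cdot>\<^sub>m tf_basis N i) $$ (a, b))"

definition alltop :: "nat \<Rightarrow> complex vec" where
  "alltop N = vec N (\<lambda>n. 1 / of_real (sqrt (real N)) *
     exp (2 * of_real pi * \<i> * of_nat (n ^ 3) / of_nat N))"

definition dictionary :: "nat \<Rightarrow> complex mat" where
  "dictionary N = mat_of_cols N (map (\<lambda>i. tf_basis N i *\<^sub>v alltop N) [0..<N\<^sup>2])"

definition sparse :: "nat \<Rightarrow> complex vec \<Rightarrow> bool" where
  "sparse K v \<longleftrightarrow> card {i. i < dim_vec v \<and> v $ i \<noteq> 0} \<le> K"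

definition l1_norm :: "complex vec \<Rightarrow> real" where
  "l1_norm v = (\<Sum>i<dim_vec v. cmod (v $ i))"

definition l2_norm :: "complex vec \<Rightarrow> real" where
  "l2_norm v = L2_set (\<lambda>i. cmod (v $ i)) {..<dim_vec v}"

definition bp_solution :: "complex mat \<Rightarrow> complex vec \<Rightarrow> complex vec \<Rightarrow> bool" where
  "bp_solution \<Phi> y s \<longleftrightarrow>
     is_arg_min l1_norm (\<lambda>s'. s' \<in> carrier_vec (dim_col \<Phi>) \<and> \<Phi> *\<^sub>v s' = y) s"

definition supported_on :: "nat set \<Rightarrow> complex vec \<Rightarrow> bool" where
  "supported_on \<Lambda> v \<longleftrightarrow> (\<forall>i<dim_vec v. i \<notin> \<Lambda> \<longrightarrow> v $ i = 0)"

definition least_squares_on ::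
  "complex mat \<Rightarrow> complex vec \<Rightarrow> nat set \<Rightarrow> complex vec \<Rightarrow> bool" where
  "least_squares_on \<Phi> y \<Lambda> s \<longleftrightarrow>
     is_arg_min (\<lambda>s'. l2_norm (y - \<Phi> *\<^sub>v s'))
       (\<lambda>s'. s' \<in> carrier_vec (dim_col \<Phi>) \<and> supported_on \<Lambda> s') s"

text \<open>\<open>omp_state \<Phi> y K t \<Lambda> s\<close>: after \<open>t\<close> steps, some admissible choice of maximizing indices
  and least-squares minimizers leads to the index set \<open>\<Lambda>\<close> and the iterate \<open>s\<close>;
  the residual is \<open>y - \<Phi> *\<^sub>v s\<close>. Tie-breaking makes this a relation rather than a function.\<close>

inductive omp_state ::
  "complex mat \<Rightarrow> complex vec \<Rightarrow> nat \<Rightarrow> nat \<Rightarrow> nat set \<Rightarrow> complex vec \<Rightarrow> bool"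
  for \<Phi> y K where
  start: "omp_state \<Phi> y K 0 {} (0\<^sub>v (dim_col \<Phi>))"
| step: "omp_state \<Phi> y K (Suc t) (insert l \<Lambda>) s'"
    if "omp_state \<Phi> y K t \<Lambda> s"
      and "t < K"
      and "y - \<Phi> *\<^sub>v s \<noteq> 0\<^sub>v (dim_row \<Phi>)"
      and "is_arg_max (\<lambda>i. cmod ((y - \<Phi> *\<^sub>v s) \<bullet>c col \<Phi> i)) (\<lambda>i. i < dim_col \<Phi>) l"
      and "least_squares_on \<Phi> y (insert l \<Lambda>) s'"

text \<open>A run stops once \<open>K\<close> steps have been made or the residual vanishes.\<close>

definition omp_output :: "complex mat \<Rightarrow> complex vec \<Rightarrow> nat \<Rightarrow> complex vec \<Rightarrow> bool" where
  "omp_output \<Phi> y K s \<longleftrightarrow>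
     (\<exists>t \<Lambda>. omp_state \<Phi> y K t \<Lambda> s \<and> (t = K \<or> y - \<Phi> *\<^sub>v s = 0\<^sub>v (dim_row \<Phi>)))"

end

theory Submission
  imports Defs
begin

text \<open>All atoms have norm 1, and the inner product of two distinct atoms is
  \<open>1 / N\<close> times the sum of a nontrivial character (same delay) or a quadratic Gauss sum
  (different delays: the cubes in the Alltop sequence cancel, leaving a quadratic phase with leading
  coefficient \<open>3 * (q' - q)\<close>, invertible mod \<open>N\<close>). So the coherence
  is at most \<open>\<mu> = 1 / sqrt N\<close>, and the sparsity bound says \<open>(2 * K - 1) * \<mu> < 1\<close>.

  For such a dictionary, comparing a kernel vector with its correlations against the atoms shows that
  fewer than half of its \<open>l1\<close> mass lies on any \<open>K\<close> indices, which gives Basis Pursuit.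
  Likewise, a residual spanned by atoms in the support correlates best with an atom of the support.
  As residuals are orthogonal to the atoms already chosen, each OMP step picks a new index
  of the support.\<close>

section \<open>Inner products and Euclidean norms in coordinates\<close>

lemma cscalar_prod_sum:
  fixes x y :: "complex vec"
  assumes "y \<in> carrier_vec m"
  shows "x \<bullet>c y = (\<Sum>k<m. x $ k * cnj (y $ k))"
  using assms by (simp add: scalar_prod_def lessThan_atLeast0)

lemma l2_norm_sq:
  assumes "v \<in> carrier_vec m"
  shows "(l2_norm v)\<^sup>2 = (\<Sum>k<m. (cmod (v $ k))\<^sup>2)"
  using assms by (simp add: l2_norm_def L2_set_def sum_nonneg)

lemma l2_norm_diff_sq:
  assumes "x \<in> carrier_vec m" "w \<in> carrier_vec m"
  shows "(l2_norm (x - w))\<^sup>2 = (l2_norm x)\<^sup>2 - 2 * Re (x \<bullet>c w) + (l2_norm w)\<^sup>2"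
proof -
  have *: "(cmod (a - b))\<^sup>2 = (cmod a)\<^sup>2 - 2 * Re (a * cnj b) + (cmod b)\<^sup>2" for a b
    unfolding cmod_power2 by (simp add: power2_eq_square algebra_simps)
  have "(l2_norm (x - w))\<^sup>2 = (\<Sum>k<m. (cmod (x $ k - w $ k))\<^sup>2)"
    using assms by (subst l2_norm_sq[of _ m]) auto
  also have "\<dots> = (\<Sum>k<m. (cmod (x $ k))\<^sup>2) - 2 * Re (\<Sum>k<m. x $ k * cnj (w $ k)) + (\<Sum>k<m. (cmod (w $ k))\<^sup>2)"
    unfolding * by (simp add: sum.distrib sum_subtractf sum_distrib_left)
  finally show ?thesis
    using assms by (simp add: l2_norm_sq cscalar_prod_sum)
qed

lemma mult_mat_vec_cscalar_prod:
  fixes \<Phi> :: "complex mat"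
  assumes "\<Phi> \<in> carrier_mat m n" "z \<in> carrier_vec n" "w \<in> carrier_vec m"
  shows "(\<Phi> *\<^sub>v z) \<bullet>c w = (\<Sum>i<n. z $ i * (col \<Phi> i \<bullet>c w))"
proof -
  have "(\<Phi> *\<^sub>v z) \<bullet>c w = (\<Sum>k<m. \<Sum>i<n. z $ i * (\<Phi> $$ (k,i) * cnj (w $ k)))"
    using assms
    by (subst cscalar_prod_sum[of _ m])
       (auto simp: scalar_prod_def lessThan_atLeast0 sum_distrib_left sum_distrib_right mult_ac intro!: sum.cong)
  also have "\<dots> = (\<Sum>i<n. z $ i * (col \<Phi> i \<bullet>c w))"
    using assms
    by (subst sum.swap) (auto simp: cscalar_prod_sum[of _ m] sum_distrib_left intro!: sum.cong)
  finally show ?thesis .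
qed

lemma cscalar_prod_mult_mat_vec:
  fixes \<Phi> :: "complex mat"
  assumes "\<Phi> \<in> carrier_mat m n" "z \<in> carrier_vec n" "w \<in> carrier_vec m"
  shows "w \<bullet>c (\<Phi> *\<^sub>v z) = (\<Sum>i<n. cnj (z $ i) * (w \<bullet>c col \<Phi> i))"
proof -
  have cj: "x \<bullet>c u = cnj (u \<bullet>c x)" if "x \<in> carrier_vec m" "u \<in> carrier_vec m" for x u :: "complex vec"
    using that by (simp add: cscalar_prod_sum[of _ m] mult.commute)
  have "w \<bullet>c (\<Phi> *\<^sub>v z) = cnj ((\<Phi> *\<^sub>v z) \<bullet>c w)"
    using assms by (intro cj) auto
  also have "\<dots> = (\<Sum>i<n. cnj (z $ i) * (w \<bullet>c col \<Phi> i))"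
    using assms by (auto simp: mult_mat_vec_cscalar_prod cj[of w] intro!: sum.cong)
  finally show ?thesis .
qed

lemma l2_norm_sq_eq:
  assumes "v \<in> carrier_vec m"
  shows "complex_of_real ((l2_norm v)\<^sup>2) = v \<bullet>c v"
  using assms by (simp add: l2_norm_sq cscalar_prod_sum complex_norm_square[symmetric] del: of_real_power)

subsection \<open>Least squares and normal equations\<close>

text \<open>Projection onto a span, built by Gram-Schmidt. The induction keeps \<open>y\<close>
  arbitrary because its hypothesis is applied twice: to \<open>y\<close> itself and to the new atom
  \<open>col \<Phi> l\<close>. Linearly dependent atoms are covered too.\<close>

lemma orthogonal_residual_exists:
  fixes \<Phi> :: "complex mat"
  assumes \<Phi>: "\<Phi> \<in> carrier_mat m n" and "finite \<Lambda>" "\<Lambda> \<subseteq> {..<n}" "y \<in> carrier_vec m"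
  shows "\<exists>z \<in> carrier_vec n. supported_on \<Lambda> z \<and> (\<forall>i\<in>\<Lambda>. (y - \<Phi> *\<^sub>v z) \<bullet>c col \<Phi> i = 0)"
  using assms(2-)
proof (induction \<Lambda> arbitrary: y rule: finite_induct)
  case empty
  show ?case by (intro bexI[of _ "0\<^sub>v n"]) (auto simp: supported_on_def)
next
  case (insert l \<Lambda>)
  note [simp] = mult_mat_vec_carrier[OF \<Phi>]
  have l: "l < n" "col \<Phi> l \<in> carrier_vec m" and \<Lambda>: "\<Lambda> \<subseteq> {..<n}"
    and y: "y \<in> carrier_vec m"
    using insert.prems \<Phi> by auto
  have orth: "w \<bullet>c (\<Phi> *\<^sub>v x) = 0"
    if "w \<in> carrier_vec m" "x \<in> carrier_vec n" "supported_on \<Lambda> x" "\<forall>i\<in>\<Lambda>. w \<bullet>c col \<Phi> i = 0" for w x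
    using that \<Phi> by (subst cscalar_prod_mult_mat_vec) (auto simp: supported_on_def intro!: sum.neutral)
  obtain z where z: "z \<in> carrier_vec n" "supported_on \<Lambda> z"
    "\<forall>i\<in>\<Lambda>. (y - \<Phi> *\<^sub>v z) \<bullet>c col \<Phi> i = 0"
    using insert.IH[OF \<Lambda> y] by blast
  obtain t where t: "t \<in> carrier_vec n" "supported_on \<Lambda> t"
    "\<forall>i\<in>\<Lambda>. (col \<Phi> l - \<Phi> *\<^sub>v t) \<bullet>c col \<Phi> i = 0"
    using insert.IH[OF \<Lambda> l(2)] by blast
  define r where "r = y - \<Phi> *\<^sub>v z"
  define w where "w = col \<Phi> l - \<Phi> *\<^sub>v t"
  have r: "r \<in> carrier_vec m" and w: "w \<in> carrier_vec m"
    using y z t l by (simp_all add: r_def w_def)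
  have col_l: "col \<Phi> l = w + \<Phi> *\<^sub>v t"
    using l t \<Phi> by (auto simp: w_def intro!: eq_vecI)
  have add_right: "u \<bullet>c (w + \<Phi> *\<^sub>v t) = u \<bullet>c w + u \<bullet>c (\<Phi> *\<^sub>v t)" if "u \<in> carrier_vec m" for u
    using that w t \<Phi>
    by (simp add: cscalar_prod_sum[of _ m] sum.distrib ring_distribs carrier_vecD[OF w] del: index_mult_mat_vec)
  have r_l: "r \<bullet>c col \<Phi> l = r \<bullet>c w"
    unfolding col_l add_right[OF r] using orth[OF r t(1,2)] z by (simp add: r_def)
  have w_l: "w \<bullet>c col \<Phi> l = w \<bullet>c w"
    unfolding col_l add_right[OF w] using orth[OF w t(1,2)] t by (simp add: w_def)
  \<comment> \<open>One Gram-Schmidt step. If \<open>w = 0\<close>, division by zero gives \<open>c = 0\<close>, which is still correct.\<close>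
  define c where "c = (r \<bullet>c w) / (w \<bullet>c w)"
  define d where "d = z + c \<cdot>\<^sub>v (unit_vec n l - t)"
  have d: "d \<in> carrier_vec n" using z t by (simp add: d_def)
  have sub: "(r - c \<cdot>\<^sub>v w) \<bullet>c u = r \<bullet>c u - c * (w \<bullet>c u)" if "u \<in> carrier_vec m" for u
    using that r w
    by (simp add: cscalar_prod_sum[of _ m] sum_subtractf sum_distrib_left algebra_simps)
  have "\<Phi> *\<^sub>v unit_vec n l = col \<Phi> l"
    using l \<Phi> by (intro eq_vecI) (auto simp: scalar_prod_right_unit)
  then have "\<Phi> *\<^sub>v d = \<Phi> *\<^sub>v z + c \<cdot>\<^sub>v w"
    using z t \<Phi> by (simp add: d_def w_def mult_add_distrib_mat_vec[of _ m n]
        mult_minus_distrib_mat_vec[of _ m n] mult_mat_vec)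
  then have res: "y - \<Phi> *\<^sub>v d = r - c \<cdot>\<^sub>v w"
    using y z w \<Phi> by (auto simp: r_def intro!: eq_vecI)
  have "w \<bullet>c w = 0 \<Longrightarrow> r \<bullet>c w = 0"
    using w r by (simp add: conjugate_square_eq_0_vec)
  then have "(r - c \<cdot>\<^sub>v w) \<bullet>c col \<Phi> l = 0"
    using l by (simp add: sub r_l w_l) (simp add: c_def)
  moreover have "(r - c \<cdot>\<^sub>v w) \<bullet>c col \<Phi> i = 0" if "i \<in> \<Lambda>" for i
    using that z t \<Lambda> \<Phi> by (subst sub) (auto simp: r_def w_def)
  moreover have "supported_on (insert l \<Lambda>) d"
    using z t l by (auto simp: supported_on_def d_def)
  ultimately show ?case
    using d res by auto
qed

text \<open>Pythagoras: a competitor \<open>x\<close> differs from \<open>z\<close> by a vector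
  supported on \<open>\<Lambda>\<close>, whose image is orthogonal to the residual. With the
  previous lemma this yields a minimizer, so an OMP step never gets stuck.\<close>

lemma least_squares_on_if_orthogonal:
  fixes \<Phi> :: "complex mat"
  assumes \<Phi>: "\<Phi> \<in> carrier_mat m n" and y: "y \<in> carrier_vec m"
    and z: "z \<in> carrier_vec n" "supported_on \<Lambda> z" "\<forall>i\<in>\<Lambda>. (y - \<Phi> *\<^sub>v z) \<bullet>c col \<Phi> i = 0"
  shows "least_squares_on \<Phi> y \<Lambda> z"
proof -
  have "l2_norm (y - \<Phi> *\<^sub>v z) \<le> l2_norm (y - \<Phi> *\<^sub>v x)"
    if x: "x \<in> carrier_vec n" "supported_on \<Lambda> x" for x
  proof -
    define r where "r = y - \<Phi> *\<^sub>v z"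
    have r: "r \<in> carrier_vec m" using \<Phi> y z by (simp add: r_def)
    have eq: "y - \<Phi> *\<^sub>v x = r - \<Phi> *\<^sub>v (x - z)"
      using y z x \<Phi>
      by (auto simp: r_def mult_minus_distrib_mat_vec[of _ m n] intro!: eq_vecI)
    have "r \<bullet>c (\<Phi> *\<^sub>v (x - z)) = 0"
      using x z \<Phi> r
      by (subst cscalar_prod_mult_mat_vec) (auto simp: supported_on_def r_def intro!: sum.neutral)
    then have "(l2_norm (y - \<Phi> *\<^sub>v x))\<^sup>2 = (l2_norm r)\<^sup>2 + (l2_norm (\<Phi> *\<^sub>v (x - z)))\<^sup>2"
      unfolding eq using x z \<Phi> r by (subst l2_norm_diff_sq[of _ m]) auto
    then have "(l2_norm r)\<^sup>2 \<le> (l2_norm (y - \<Phi> *\<^sub>v x))\<^sup>2" by simp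
    then show ?thesis
      unfolding r_def by (rule power2_le_imp_le) (simp add: l2_norm_def L2_set_nonneg)
  qed
  then show ?thesis
    using z \<Phi> by (auto simp: least_squares_on_def is_arg_min_linorder)
qed

lemma ex_is_arg_max_if_finite:
  fixes f :: "'a \<Rightarrow> 'b :: linorder"
  assumes "finite A" "A \<noteq> {}"
  shows "\<exists>x. is_arg_max f (\<lambda>x. x \<in> A) x"
proof -
  have "Max (f ` A) \<in> f ` A"
    using assms by (intro Max_in) auto
  then obtain x where x: "x \<in> A" "Max (f ` A) = f x"
    by auto
  have "f y \<le> f x" if "y \<in> A" for y
    using that assms(1) unfolding x(2)[symmetric] by simp
  then show ?thesis
    using x(1) by (auto simp: is_arg_max_linorder)
qed

subsection \<open>Recovery from incoherent dictionaries\<close>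

text \<open>Recovery depends on the dictionary only through these properties. The condition
  \<open>(2 * k - 1) * \<mu> < 1\<close> on a sparsity \<open>k\<close> appears below as
  \<open>2 * k * \<mu> < 1 + \<mu>\<close>, which avoids subtraction.\<close>

locale incoherent_dictionary =
  fixes \<Phi> :: "complex mat" and m n :: nat and \<mu> :: real
  assumes carrier: "\<Phi> \<in> carrier_mat m n"
    and unit_col: "\<And>i. i < n \<Longrightarrow> col \<Phi> i \<bullet>c col \<Phi> i = 1"
    and coherence: "\<And>i j. i < n \<Longrightarrow> j < n \<Longrightarrow> i \<noteq> j \<Longrightarrow> cmod (col \<Phi> i \<bullet>c col \<Phi> j) \<le> \<mu>"
    and mu_nonneg: "0 \<le> \<mu>"
begin

lemma dims [simp]: "dim_row \<Phi> = m" "dim_col \<Phi> = n"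
  using carrier by auto

lemma mult_zero_vec: "\<Phi> *\<^sub>v 0\<^sub>v n = 0\<^sub>v m"
  using mult_minus_distrib_mat_vec[OF carrier, of "0\<^sub>v n" "0\<^sub>v n"]
  by (intro eq_vecI) (simp_all add: scalar_prod_def)

text \<open>Adding \<open>c\<close> to entry \<open>i\<close>, where \<open>c\<close> is the
  correlation of the residual with atom \<open>i\<close>, lowers the squared residual norm by
  exactly the square of \<open>cmod c\<close>, since the atom has norm 1. Minimality forces
  \<open>c = 0\<close>.\<close>

lemma orthogonal_if_least_squares_on:
  assumes y: "y \<in> carrier_vec m" and ls: "least_squares_on \<Phi> y \<Lambda> z" and i: "i \<in> \<Lambda>" "i < n"
  shows "(y - \<Phi> *\<^sub>v z) \<bullet>c col \<Phi> i = 0"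
proof -
  define r where "r = y - \<Phi> *\<^sub>v z"
  define c where "c = r \<bullet>c col \<Phi> i"
  define d where "d = c \<cdot>\<^sub>v unit_vec n i"
  have z: "z \<in> carrier_vec n" "supported_on \<Lambda> z"
    and min: "\<And>x. x \<in> carrier_vec n \<Longrightarrow> supported_on \<Lambda> x \<Longrightarrow> l2_norm r \<le> l2_norm (y - \<Phi> *\<^sub>v x)"
    using ls by (auto simp: least_squares_on_def is_arg_min_linorder r_def)
  have r: "r \<in> carrier_vec m" using carrier y z by (simp add: r_def)
  have d: "d \<in> carrier_vec n" by (simp add: d_def)
  \<comment> \<open>Only entry \<open>i\<close> of \<open>d\<close> can be nonzero. Below,
    \<open>f\<close> is \<open>cnj\<close> or the identity.\<close>
  have sumd: "(\<Sum>j<n. f (d $ j) * g j) = f c * g i" if "f 0 = 0" for f g :: "_ \<Rightarrow> complex"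
  proof -
    have "(\<Sum>j<n. f (d $ j) * g j) = (\<Sum>j<n. if j = i then f c * g i else 0)"
      using that i by (intro sum.cong) (auto simp: d_def)
    then show ?thesis using i by simp
  qed
  have rd: "r \<bullet>c (\<Phi> *\<^sub>v d) = cnj c * c"
    using sumd[of cnj] r d by (simp add: cscalar_prod_mult_mat_vec[OF carrier] c_def)
  have rr: "Re (r \<bullet>c (\<Phi> *\<^sub>v d)) = (cmod c)\<^sup>2"
    unfolding rd cmod_power2 by (simp add: power2_eq_square)
  have "(\<Phi> *\<^sub>v d) \<bullet>c (\<Phi> *\<^sub>v d) = cnj c * ((\<Phi> *\<^sub>v d) \<bullet>c col \<Phi> i)"
    using sumd[of cnj] d carrier by (subst cscalar_prod_mult_mat_vec[OF carrier]) auto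
  also have "(\<Phi> *\<^sub>v d) \<bullet>c col \<Phi> i = c"
    using sumd[of "\<lambda>x. x"] d i carrier unit_col by (subst mult_mat_vec_cscalar_prod[OF carrier]) auto
  finally have dd: "(l2_norm (\<Phi> *\<^sub>v d))\<^sup>2 = (cmod c)\<^sup>2"
    using d carrier l2_norm_sq_eq[of "\<Phi> *\<^sub>v d" m] by (simp add: mult.commute complex_norm_square[symmetric] del: of_real_power flip: of_real_power)
  have "y - \<Phi> *\<^sub>v (z + d) = r - \<Phi> *\<^sub>v d"
    using y z d carrier
    by (auto simp: r_def mult_add_distrib_mat_vec[of _ m n] intro!: eq_vecI)
  moreover have "supported_on \<Lambda> (z + d)"
    using z i by (auto simp: supported_on_def d_def)
  ultimately have "l2_norm r \<le> l2_norm (r - \<Phi> *\<^sub>v d)"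
    using min[of "z + d"] z d by simp
  then have "(l2_norm r)\<^sup>2 \<le> (l2_norm (r - \<Phi> *\<^sub>v d))\<^sup>2"
    by (intro power_mono) (simp_all add: l2_norm_def L2_set_nonneg)
  also have "\<dots> = (l2_norm r)\<^sup>2 - (cmod c)\<^sup>2"
    using l2_norm_diff_sq[OF r, of "\<Phi> *\<^sub>v d"] d carrier rr dd by simp
  finally show ?thesis by (simp add: c_def r_def)
qed

text \<open>Expanding in atoms, atom \<open>j\<close> contributes exactly \<open>z $ j\<close>, and
  every other atom at most \<open>\<mu>\<close> times the modulus of its coefficient. The Basis
  Pursuit and OMP arguments both rest on this estimate.\<close>

lemma correlation_bound:
  assumes z: "z \<in> carrier_vec n" and j: "j < n"
  shows "cmod ((\<Phi> *\<^sub>v z) \<bullet>c col \<Phi> j - z $ j) \<le> \<mu> * (l1_norm z - cmod (z $ j))"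
proof -
  have "(\<Phi> *\<^sub>v z) \<bullet>c col \<Phi> j = (\<Sum>i<n. z $ i * (col \<Phi> i \<bullet>c col \<Phi> j))"
    using z j carrier by (intro mult_mat_vec_cscalar_prod) auto
  also have "\<dots> = z $ j + (\<Sum>i\<in>{..<n} - {j}. z $ i * (col \<Phi> i \<bullet>c col \<Phi> j))"
    using j unit_col by (subst sum.remove[of _ j]) auto
  finally have "cmod ((\<Phi> *\<^sub>v z) \<bullet>c col \<Phi> j - z $ j) =
      cmod (\<Sum>i\<in>{..<n} - {j}. z $ i * (col \<Phi> i \<bullet>c col \<Phi> j))" by simp
  also have "\<dots> \<le> (\<Sum>i\<in>{..<n} - {j}. cmod (z $ i) * \<mu>)"
    using j coherence by (intro sum_norm_le) (auto simp: norm_mult intro!: mult_left_mono)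
  also have "\<dots> = \<mu> * (l1_norm z - cmod (z $ j))"
    using j z by (simp add: l1_norm_def sum_diff1 sum_distrib_right[symmetric]
        sum_distrib_left[symmetric] mult.commute[of _ \<mu>] right_diff_distrib)
  finally show ?thesis .
qed

text \<open>All correlations of a kernel vector vanish, so the correlation bound limits each single
  entry by \<open>\<mu> / (1 + \<mu>)\<close> of the \<open>l1\<close> mass. Summing over
  \<open>S\<close> gives less than half of that mass.\<close>

lemma null_space_property:
  assumes z: "z \<in> carrier_vec n" "\<Phi> *\<^sub>v z = 0\<^sub>v m" "z \<noteq> 0\<^sub>v n"
    and S: "S \<subseteq> {..<n}" "2 * real (card S) * \<mu> < 1 + \<mu>"
  shows "2 * (\<Sum>i\<in>S. cmod (z $ i)) < l1_norm z"
proof (rule ccontr)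
  assume *: "\<not> ?thesis"
  obtain p where "p < n" "z $ p \<noteq> 0"
    using z by (metis eq_vecI carrier_vecD index_zero_vec)
  then have pos: "l1_norm z > 0"
    using z by (auto simp: l1_norm_def intro!: sum_pos2[of _ p])
  have "(1 + \<mu>) * cmod (z $ j) \<le> \<mu> * l1_norm z" if "j \<in> S" for j
  proof -
    have "j < n" using that S by auto
    then have "(\<Phi> *\<^sub>v z) \<bullet>c col \<Phi> j = 0"
      using z carrier by (simp add: cscalar_prod_sum[of _ m])
    then show ?thesis
      using correlation_bound[OF z(1) \<open>j < n\<close>] by (simp add: algebra_simps)
  qed
  then have "(\<Sum>i\<in>S. (1 + \<mu>) * cmod (z $ i)) \<le> (\<Sum>i\<in>S. \<mu> * l1_norm z)"
    by (intro sum_mono)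
  then have le: "(1 + \<mu>) * (\<Sum>i\<in>S. cmod (z $ i)) \<le> real (card S) * \<mu> * l1_norm z"
    by (simp add: sum_distrib_left)
  have "(1 + \<mu>) * l1_norm z \<le> (1 + \<mu>) * (2 * (\<Sum>i\<in>S. cmod (z $ i)))"
    using * mu_nonneg by (intro mult_left_mono) auto
  also have "\<dots> \<le> 2 * real (card S) * \<mu> * l1_norm z"
    using le by simp
  also have "\<dots> < (1 + \<mu>) * l1_norm z"
    using S(2) pos by (intro mult_strict_right_mono)
  finally show False by simp
qed

lemma l1_norm_supported_on:
  assumes "z \<in> carrier_vec n" "S \<subseteq> {..<n}" "supported_on S z"
  shows "l1_norm z = (\<Sum>i\<in>S. cmod (z $ i))"
  unfolding l1_norm_def using assms
  by (intro sum.mono_neutral_right) (auto simp: supported_on_def)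

text \<open>All the mass of \<open>z\<close> would lie on \<open>S\<close>, against the null space
  property. This identifies the iterate when OMP stops with zero residual.\<close>

lemma eq_zero_if_sparse_kernel:
  assumes "z \<in> carrier_vec n" "\<Phi> *\<^sub>v z = 0\<^sub>v m" "S \<subseteq> {..<n}" "2 * real (card S) * \<mu> < 1 + \<mu>"
    "supported_on S z"
  shows "z = 0\<^sub>v n"
proof (rule ccontr)
  assume "z \<noteq> 0\<^sub>v n"
  from null_space_property[OF assms(1,2) this assms(3,4)]
  have "l1_norm z < 0"
    by (simp add: l1_norm_supported_on[OF assms(1,3,5)])
  then show False by (simp add: l1_norm_def sum_nonneg flip: not_le)
qed

text \<open>A feasible \<open>x\<close> is \<open>s + h\<close> with \<open>h\<close> in the kernel.
  Passing from \<open>s\<close> to \<open>x\<close> loses at most the mass of \<open>h\<close> on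
  \<open>S\<close> and gains its mass off \<open>S\<close>, which is larger.\<close>

lemma bp_solution_iff:
  assumes s: "s \<in> carrier_vec n" "supported_on S s"
    and S: "S \<subseteq> {..<n}" "2 * real (card S) * \<mu> < 1 + \<mu>"
  shows "bp_solution \<Phi> (\<Phi> *\<^sub>v s) s' \<longleftrightarrow> s' = s"
proof -
  have less: "l1_norm s < l1_norm x"
    if x: "x \<in> carrier_vec n" "\<Phi> *\<^sub>v x = \<Phi> *\<^sub>v s" "x \<noteq> s" for x
  proof -
    define h where "h = x - s"
    have h: "h \<in> carrier_vec n" using x s by (simp add: h_def)
    have "\<Phi> *\<^sub>v h = 0\<^sub>v m"
      using x s carrier by (auto simp: h_def mult_minus_distrib_mat_vec[of _ m n])
    moreover have "h \<noteq> 0\<^sub>v n"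
    proof
      assume "h = 0\<^sub>v n"
      then have "x $ i - s $ i = 0" if "i < n" for i
        using that x s by (metis h_def carrier_vecD index_minus_vec(1) index_zero_vec(1))
      then show False using x s by (auto intro: eq_vecI)
    qed
    ultimately have nsp: "2 * (\<Sum>i\<in>S. cmod (h $ i)) < l1_norm h"
      using null_space_property h S by blast
    have split: "l1_norm v = (\<Sum>i\<in>S. cmod (v $ i)) + (\<Sum>i\<in>{..<n} - S. cmod (v $ i))"
      if "v \<in> carrier_vec n" for v
      using that S by (simp add: l1_norm_def sum.subset_diff[of S])
    have "(\<Sum>i\<in>S. cmod (s $ i)) - (\<Sum>i\<in>S. cmod (h $ i)) \<le> (\<Sum>i\<in>S. cmod (x $ i))"
      unfolding sum_subtractf[symmetric]
    proof (rule sum_mono)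
      fix i assume "i \<in> S"
      then have "h $ i = x $ i - s $ i" using S x s by (auto simp: h_def)
      then show "cmod (s $ i) - cmod (h $ i) \<le> cmod (x $ i)"
        using norm_triangle_ineq2[of "s $ i" "s $ i - x $ i"] by (simp add: norm_minus_commute)
    qed
    moreover have "(\<Sum>i\<in>{..<n} - S. cmod (x $ i)) = (\<Sum>i\<in>{..<n} - S. cmod (h $ i))"
      using x s by (intro sum.cong) (auto simp: h_def supported_on_def)
    ultimately show ?thesis
      using nsp split[OF h] split[OF x(1)] l1_norm_supported_on[OF s(1) S(1) s(2)] by linarith
  qed
  show ?thesis
    using s less[THEN less_asym] less by (auto simp: bp_solution_def is_arg_min_def)
qed

text \<open>Let \<open>p\<close> carry the largest coefficient. The sparsity bound makes the
  correlation with atom \<open>p\<close> exceed \<open>\<mu> * l1_norm z\<close>, whereas an atom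
  outside \<open>S\<close> reaches at most that value.\<close>

lemma is_arg_max_correlation:
  assumes z: "z \<in> carrier_vec n" "supported_on S z" "z \<noteq> 0\<^sub>v n"
    and S: "S \<subseteq> {..<n}" "2 * real (card S) * \<mu> < 1 + \<mu>"
    and l: "is_arg_max (\<lambda>i. cmod ((\<Phi> *\<^sub>v z) \<bullet>c col \<Phi> i)) (\<lambda>i. i < n) l"
  shows "l \<in> S" "(\<Phi> *\<^sub>v z) \<bullet>c col \<Phi> l \<noteq> 0"
proof -
  let ?c = "\<lambda>i. (\<Phi> *\<^sub>v z) \<bullet>c col \<Phi> i"
  have "finite S" using S finite_subset by blast
  obtain q where q: "q < n" "z $ q \<noteq> 0"
    using z by (metis eq_vecI carrier_vecD index_zero_vec)
  then have "q \<in> S" using z by (auto simp: supported_on_def)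
  obtain p where p: "p \<in> S" "\<And>i. i \<in> S \<Longrightarrow> cmod (z $ i) \<le> cmod (z $ p)"
    using ex_is_arg_max_if_finite[of S "\<lambda>i. cmod (z $ i)"] \<open>finite S\<close> \<open>q \<in> S\<close>
    by (auto simp: is_arg_max_linorder)
  have pos: "cmod (z $ p) > 0"
    using p(2)[OF \<open>q \<in> S\<close>] q by (meson zero_less_norm_iff less_le_trans)
  have "p < n" using p S by auto
  have "l1_norm z \<le> real (card S) * cmod (z $ p)"
    unfolding l1_norm_supported_on[OF z(1) S(1) z(2)] using p by (intro sum_bounded_above)
  then have "2 * (\<mu> * l1_norm z) \<le> 2 * real (card S) * \<mu> * cmod (z $ p)"
    using mult_left_mono[OF _ mu_nonneg] by (fastforce simp: mult_ac)
  also have "\<dots> < (1 + \<mu>) * cmod (z $ p)"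
    using S(2) pos by (intro mult_strict_right_mono)
  finally have lt: "2 * (\<mu> * l1_norm z) < (1 + \<mu>) * cmod (z $ p)" .
  have "cmod (z $ p) - cmod (?c p) \<le> cmod (?c p - z $ p)"
    by (metis norm_minus_commute norm_triangle_ineq2)
  then have "(1 + \<mu>) * cmod (z $ p) - \<mu> * l1_norm z \<le> cmod (?c p)"
    using correlation_bound[OF z(1) \<open>p < n\<close>] by (simp add: algebra_simps)
  also have "\<dots> \<le> cmod (?c l)"
    using l \<open>p < n\<close> by (auto simp: is_arg_max_linorder)
  finally have c_l: "\<mu> * l1_norm z < cmod (?c l)" using lt by linarith
  have "0 \<le> \<mu> * l1_norm z"
    using mu_nonneg by (simp add: l1_norm_def sum_nonneg)
  then show "?c l \<noteq> 0" using c_l by auto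
  show "l \<in> S"
  proof (rule ccontr)
    assume "l \<notin> S"
    moreover have "l < n" using l by (simp add: is_arg_max_linorder)
    ultimately have "z $ l = 0" using z by (auto simp: supported_on_def)
    then show False using correlation_bound[OF z(1) \<open>l < n\<close>] c_l by simp
  qed
qed

section \<open>Runs of Orthogonal Matching Pursuit\<close>

lemma arg_max_correlation_exists:
  assumes "0 < n"
  shows "\<exists>l. is_arg_max (\<lambda>i. cmod (r \<bullet>c col \<Phi> i)) (\<lambda>i. i < n) l"
  using ex_is_arg_max_if_finite[of "{..<n}"] assms by auto

text \<open>Every residual is \<open>\<Phi> *\<^sub>v (s - x)\<close> with \<open>s - x\<close>
  supported on \<open>S\<close>, so the selection lemma applies at each step. One half shows that
  any output is \<open>s\<close>, the other that some run produces an output.\<close>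

lemma omp_output_iff:
  assumes s: "s \<in> carrier_vec n" "supported_on S s"
    and S: "S \<subseteq> {..<n}" "card S \<le> K" "2 * real K * \<mu> < 1 + \<mu>"
  shows "omp_output \<Phi> (\<Phi> *\<^sub>v s) K s' \<longleftrightarrow> s' = s"
proof -
  let ?y = "\<Phi> *\<^sub>v s"
  have "finite S" using S finite_subset by blast
  have y: "?y \<in> carrier_vec m" using s carrier by simp
  have "2 * real (card S) * \<mu> \<le> 2 * real K * \<mu>"
    using S mu_nonneg by (intro mult_right_mono) auto
  then have S': "2 * real (card S) * \<mu> < 1 + \<mu>" using S by linarith
  have diff: "?y - \<Phi> *\<^sub>v x = \<Phi> *\<^sub>v (s - x)" "s - x \<in> carrier_vec n" if "x \<in> carrier_vec n" for x
    using that s carrier by (simp_all add: mult_minus_distrib_mat_vec[of _ m n])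
  have diff_0: "x = s" if "s - x = 0\<^sub>v n" "x \<in> carrier_vec n" for x
  proof (rule eq_vecI)
    fix i assume "i < dim_vec s"
    then have "s $ i - x $ i = 0"
      using that s by (metis carrier_vecD index_minus_vec(1) index_zero_vec(1))
    then show "x $ i = s $ i" by simp
  qed (use that s in auto)
  \<comment> \<open>The invariant of a run; \<open>card \<Lambda> = t\<close> records that no index
    is selected twice.\<close>
  have inv: "x \<in> carrier_vec n \<and> supported_on S x \<and> \<Lambda> \<subseteq> S \<and> card \<Lambda> = t \<and>
      (\<forall>i\<in>\<Lambda>. (?y - \<Phi> *\<^sub>v x) \<bullet>c col \<Phi> i = 0)"
    if "omp_state \<Phi> ?y K t \<Lambda> x" for t \<Lambda> x
    using that
  proof (induction rule: omp_state.induct)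
    case start
    show ?case by (auto simp: supported_on_def)
  next
    case (step t \<Lambda> x l x')
    then have x: "x \<in> carrier_vec n" "supported_on S x" "\<Lambda> \<subseteq> S" "card \<Lambda> = t"
      "\<forall>i\<in>\<Lambda>. (?y - \<Phi> *\<^sub>v x) \<bullet>c col \<Phi> i = 0" by auto
    have "supported_on S (s - x)"
      using s x by (auto simp: supported_on_def)
    moreover have "s - x \<noteq> 0\<^sub>v n"
      using step.hyps(3) mult_zero_vec by (auto simp: diff(1)[OF x(1)])
    moreover have "is_arg_max (\<lambda>i. cmod ((\<Phi> *\<^sub>v (s - x)) \<bullet>c col \<Phi> i)) (\<lambda>i. i < n) l"
      using step.hyps(4) by (simp add: diff(1)[OF x(1)])
    ultimately have l: "l \<in> S" "(?y - \<Phi> *\<^sub>v x) \<bullet>c col \<Phi> l \<noteq> 0"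
      using is_arg_max_correlation[of "s - x" S l] S S' diff[OF x(1)] by simp_all
    have x': "x' \<in> carrier_vec n" "supported_on (insert l \<Lambda>) x'"
      using step.hyps(5) by (auto simp: least_squares_on_def is_arg_min_def)
    have "(?y - \<Phi> *\<^sub>v x') \<bullet>c col \<Phi> i = 0" if "i \<in> insert l \<Lambda>" for i
      using orthogonal_if_least_squares_on[OF y step.hyps(5) that] that l x S by auto
    \<comment> \<open>The residual is orthogonal to the atoms of \<open>\<Lambda>\<close> but has
      nonzero correlation with atom \<open>l\<close>.\<close>
    moreover have "l \<notin> \<Lambda>" using x l by auto
    moreover have "finite \<Lambda>" using x \<open>finite S\<close> finite_subset by blast
    ultimately show ?case
      using x x' l by (auto simp: supported_on_def)
  qed
  have output_eq: "x = s" if out: "omp_output \<Phi> ?y K x" for x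
  proof -
    obtain t \<Lambda> where st: "omp_state \<Phi> ?y K t \<Lambda> x" and fin: "t = K \<or> ?y - \<Phi> *\<^sub>v x = 0\<^sub>v m"
      using out by (auto simp: omp_output_def)
    note x = inv[OF st]
    have supp: "supported_on S (s - x)"
      using s x by (auto simp: supported_on_def)
    from fin have "s - x = 0\<^sub>v n"
    proof
      assume "t = K"
      \<comment> \<open>\<open>\<Lambda>\<close> is a subset of \<open>S\<close> with
        \<open>K\<close> elements, and \<open>card S \<le> K\<close>. A nonzero \<open>s - x\<close>
        would then correlate with some atom of \<open>\<Lambda>\<close>, against
        orthogonality.\<close>
      then have "\<Lambda> = S"
        using x S \<open>finite S\<close> by (intro card_seteq) auto
      show ?thesis
      proof (rule ccontr)
        assume nz: "s - x \<noteq> 0\<^sub>v n"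
        then have "n > 0" using s x by (auto intro!: Nat.gr0I)
        then obtain l where
          l: "is_arg_max (\<lambda>i. cmod ((\<Phi> *\<^sub>v (s - x)) \<bullet>c col \<Phi> i)) (\<lambda>i. i < n) l"
          using arg_max_correlation_exists by blast
        from is_arg_max_correlation[OF _ supp nz S(1) S' l] x \<open>\<Lambda> = S\<close> show False
          by (auto simp: diff)
      qed
    next
      assume "?y - \<Phi> *\<^sub>v x = 0\<^sub>v m"
      then show ?thesis
        using eq_zero_if_sparse_kernel[OF _ _ S(1) S' supp] x by (auto simp: diff)
    qed
    then show ?thesis using diff_0 x by blast
  qed
  \<comment> \<open>A run can be prolonged to any length up to \<open>K\<close> unless its residual
    vanishes earlier, in which case \<open>u\<close> remains the stopping time.\<close>
  have run: "\<exists>u \<Lambda> x. omp_state \<Phi> ?y K u \<Lambda> x \<and> (u = t \<or> ?y - \<Phi> *\<^sub>v x = 0\<^sub>v m)" if "t \<le> K" for t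
    using that
  proof (induction t)
    case 0
    show ?case using omp_state.start by blast
  next
    case (Suc t)
    then obtain u \<Lambda> x where st: "omp_state \<Phi> ?y K u \<Lambda> x" and "u = t \<or> ?y - \<Phi> *\<^sub>v x = 0\<^sub>v m"
      by auto
    then consider "?y - \<Phi> *\<^sub>v x = 0\<^sub>v m" | "u = t" "?y - \<Phi> *\<^sub>v x \<noteq> 0\<^sub>v m" by blast
    then show ?case
    proof cases
      case 1
      then show ?thesis using st by blast
    next
      case 2
      note x = inv[OF st]
      \<comment> \<open>A maximizing index needs at least one column; without columns the residual
        would be zero.\<close>
      have "n > 0"
      proof (rule Nat.gr0I)
        assume "n = 0"
        then have "s - x = 0\<^sub>v n" using diff(2) x by auto
        then show False using 2 mult_zero_vec diff(1)[of x] x by simp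
      qed
      then obtain l where
        l: "is_arg_max (\<lambda>i. cmod ((?y - \<Phi> *\<^sub>v x) \<bullet>c col \<Phi> i)) (\<lambda>i. i < n) l"
        using arg_max_correlation_exists by blast
      then have "insert l \<Lambda> \<subseteq> {..<n}" "finite (insert l \<Lambda>)"
        using x S \<open>finite S\<close> by (auto simp: is_arg_max_linorder intro: finite_subset)
      then obtain z where "least_squares_on \<Phi> ?y (insert l \<Lambda>) z"
        using orthogonal_residual_exists[OF carrier _ _ y] least_squares_on_if_orthogonal[OF carrier y]
        by meson
      then have "omp_state \<Phi> ?y K (Suc t) (insert l \<Lambda>) z"
        using st 2 l Suc.prems by (intro omp_state.step[of _ _ _ t \<Lambda> x]) auto
      then show ?thesis by blast
    qed
  qed
  have "\<exists>x. omp_output \<Phi> ?y K x"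
    using run[of K] by (auto simp: omp_output_def)
  then show ?thesis using output_eq by blast
qed

end

subsection \<open>Coherence of the Alltop dictionary\<close>

definition chi :: "nat \<Rightarrow> int \<Rightarrow> complex" where
  "chi N k = cis (2 * pi * of_int k / of_nat N)"

lemma chi_add: "chi N (a + b) = chi N a * chi N b"
  by (simp add: chi_def cis_mult ring_distribs add_divide_distrib)

lemma chi_0 [simp]: "chi N 0 = 1"
  by (simp add: chi_def)

text \<open>Conjugation negates the argument, which is why \<open>chi\<close> takes
  integers.\<close>

lemma cnj_chi: "cnj (chi N a) = chi N (- a)"
  by (simp add: chi_def cis_cnj)

lemma chi_mult_of_nat: "chi N (a * int k) = chi N a ^ k"
  by (simp add: chi_def Complex.DeMoivre mult_ac)

lemma chi_eq_1_iff:
  assumes "N > 0"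
  shows "chi N a = 1 \<longleftrightarrow> int N dvd a"
proof
  assume "chi N a = 1"
  then have "cos (2 * pi * of_int a / of_nat N) = 1"
    by (metis chi_def cis.simps(1) one_complex.simps(1))
  then obtain j :: int where "2 * pi * of_int a / of_nat N = of_int j * 2 * pi"
    by (auto simp: cos_one_2pi_int)
  then have "real_of_int a = of_int (j * int N)"
    using assms by (simp add: field_simps)
  then show "int N dvd a"
    by (metis dvd_triv_right of_int_eq_iff)
next
  assume "int N dvd a"
  then obtain j where "a = int N * j" ..
  then have "chi N a = cis (2 * pi * of_int j)"
    using assms by (simp add: chi_def mult.assoc)
  also have "\<dots> = 1"
    by (rule cis_multiple_2pi) (rule Ints_of_int)
  finally show "chi N a = 1" .
qed

lemma chi_cong:
  assumes "int N dvd a - b" "N > 0"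
  shows "chi N a = chi N b"
  using chi_add[of N "a - b" b] chi_eq_1_iff[of N "a - b"] assms by simp

text \<open>Orthogonality of characters: a geometric sum whose ratio is an \<open>N\<close>-th root
  of unity.\<close>

lemma sum_chi_linear:
  assumes "N > 0"
  shows "(\<Sum>k<N. chi N (a * int k)) = (if int N dvd a then of_nat N else 0)"
proof (cases "int N dvd a")
  case True
  then have "chi N a = 1"
    using chi_eq_1_iff assms by blast
  then show ?thesis using True by (simp add: chi_mult_of_nat)
next
  case False
  then have "chi N a \<noteq> 1"
    using chi_eq_1_iff assms by blast
  moreover have "chi N a ^ N = 1"
    using assms by (simp flip: chi_mult_of_nat add: chi_eq_1_iff)
  ultimately show ?thesis
    using False by (simp add: chi_mult_of_nat geometric_sum)
qed

text \<open>Advancing the window by one trades \<open>f d\<close> for the equal term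
  \<open>f (d + N)\<close>.\<close>

lemma sum_periodic_shift:
  fixes f :: "nat \<Rightarrow> 'a :: ab_group_add"
  assumes "\<And>k. f (k + N) = f k"
  shows "(\<Sum>k<N. f (k + d)) = (\<Sum>k<N. f k)"
proof (induction d)
  case (Suc d)
  have "(\<Sum>k<N. f (k + Suc d)) + f d = (\<Sum>k<Suc N. f (k + d))"
    by (subst sum.lessThan_Suc_shift) simp
  also have "\<dots> = (\<Sum>k<N. f (k + d)) + f d"
    using assms[of d] by (simp add: add.commute)
  finally show ?case using Suc by simp
qed simp

text \<open>In the squared modulus, a double sum over \<open>j\<close> and \<open>k\<close>,
  substituting \<open>j = d + k\<close> cancels the square of \<open>k\<close>. The sum over
  \<open>k\<close> is then a character sum with coefficient \<open>2 * a * d\<close>, nonzero only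
  for \<open>d = 0\<close>.\<close>

lemma norm_quadratic_gauss_sum:
  assumes "coprime (2 * a) (int N)" "N > 0"
  shows "cmod (\<Sum>k<N. chi N (a * (int k)\<^sup>2 + b * int k + c)) = sqrt (real N)"
proof -
  define Q where "Q k = a * (int k)\<^sup>2 + b * int k + c" for k
  let ?G = "\<Sum>k<N. chi N (Q k)"
  have diff: "Q (d + k) - Q k = (a * (int d)\<^sup>2 + b * int d) + (2 * a * int d) * int k" for k d
    by (simp add: Q_def algebra_simps power2_eq_square)
  \<comment> \<open>Periodicity in \<open>j\<close> permits the substitution
    \<open>j = d + k\<close> without reduction modulo \<open>N\<close>.\<close>
  have per: "chi N (Q (j + N) - Q k) = chi N (Q j - Q k)" for j k
  proof (rule chi_cong)
    have "Q (j + N) - Q k - (Q j - Q k) = int N * (a * (2 * int j + int N) + b)"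
      by (simp add: Q_def algebra_simps power2_eq_square)
    then show "int N dvd Q (j + N) - Q k - (Q j - Q k)" by simp
  qed fact
  have dvd: "int N dvd 2 * a * int d \<longleftrightarrow> d = 0" if "d < N" for d
  proof -
    have "int N dvd 2 * a * int d \<longleftrightarrow> int N dvd int d"
      using assms(1) by (meson coprime_commute coprime_dvd_mult_right_iff)
    then show ?thesis
      using that by (auto simp: nat_dvd_not_less)
  qed
  have "?G * cnj ?G = (\<Sum>k<N. \<Sum>j<N. chi N (Q j - Q k))"
    by (subst sum.swap) (simp add: cnj_chi sum_product chi_add[symmetric])
  also have "\<dots> = (\<Sum>k<N. \<Sum>d<N. chi N (Q (d + k) - Q k))"
    by (intro sum.cong refl sum_periodic_shift[symmetric] per)
  also have "\<dots> = (\<Sum>d<N. chi N (a * (int d)\<^sup>2 + b * int d) * (\<Sum>k<N. chi N (2 * a * int d * int k)))"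
    by (subst sum.swap) (simp only: diff chi_add sum_distrib_left)
  also have "\<dots> = (\<Sum>d<N. if d = 0 then of_nat N else 0)"
    using dvd assms(2) by (intro sum.cong refl) (simp add: sum_chi_linear)
  also have "\<dots> = of_nat N"
    using assms(2) by simp
  finally have "?G * cnj ?G = of_nat N" .
  then have "complex_of_real ((cmod ?G)\<^sup>2) = complex_of_real (real N)"
    by (simp only: complex_norm_square of_real_of_nat_eq)
  then have "(cmod ?G)\<^sup>2 = real N"
    by (simp only: of_real_eq_iff)
  then show ?thesis
    unfolding Q_def by (intro real_sqrt_unique[symmetric]) simp_all
qed

section \<open>Powers of the shift and modulation matrices, and the entries of the atoms\<close>

lemma index_shift_mat:
  "a < N \<Longrightarrow> b < N \<Longrightarrow> shift_mat N $$ (a, b) = (if a = (b + 1) mod N then 1 else 0)"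
  "dim_row (shift_mat N) = N" "dim_col (shift_mat N) = N"
  by (simp_all add: shift_mat_def)

lemma shift_mat_pow:
  "shift_mat N ^\<^sub>m q = mat N N (\<lambda>(a, b). if a = (b + q) mod N then 1 else 0)"
proof (induction q)
  case 0
  show ?case by (auto simp: shift_mat_def)
next
  case (Suc q)
  have "(shift_mat N ^\<^sub>m q * shift_mat N) $$ (a, b) = (if a = (b + Suc q) mod N then 1 else 0)"
    if "a < N" "b < N" for a b
  proof -
    have "(shift_mat N ^\<^sub>m q * shift_mat N) $$ (a, b) =
        (\<Sum>c<N. (if a = (c + q) mod N then 1 else 0) * (if c = (b + 1) mod N then 1 else 0))"
      using that by (simp add: Suc index_shift_mat scalar_prod_def lessThan_atLeast0)
    also have "\<dots> = (\<Sum>c<N. if c = (b + 1) mod N then (if a = (c + q) mod N then 1 else 0) else 0)"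
      by (intro sum.cong) auto
    also have "\<dots> = (if a = (b + Suc q) mod N then 1 else 0)"
      using that by (simp add: mod_simps)
    finally show ?thesis .
  qed
  then show ?case
    by (intro eq_matI) (simp_all add: index_shift_mat)
qed

lemma modulation_mat_pow:
  "modulation_mat N ^\<^sub>m m = mat_diag N (\<lambda>k. chi N (int m * int k))"
proof (induction m)
  case 0
  show ?case by (simp add: modulation_mat_def mat_diag_def)
next
  case (Suc m)
  have "root_of_unity N = chi N 1"
    by (simp add: root_of_unity_def chi_def cis_conv_exp mult_ac)
  then have "root_of_unity N ^ k = chi N (int k)" for k
    by (simp flip: chi_mult_of_nat)
  then have "modulation_mat N = mat_diag N (\<lambda>k. chi N (int k))"
    by (simp add: modulation_mat_def)
  then show ?case
    using Suc by (simp add: chi_add[symmetric] algebra_simps)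
qed

lemma alltop_index:
  "k < N \<Longrightarrow> alltop N $ k = chi N (int k ^ 3) / of_real (sqrt (real N))"
  by (simp add: alltop_def chi_def cis_conv_exp mult_ac)

lemma dim_vec_alltop: "dim_vec (alltop N) = N"
  by (simp add: alltop_def)

lemma tf_basis_carrier: "tf_basis N i \<in> carrier_mat N N"
  by (simp add: tf_basis_def shift_mat_def modulation_mat_def mat_diag_def carrier_matI)

text \<open>A delay by \<open>i div N\<close> followed by a modulation. The cyclic wraparound leaves
  no trace, as the cube enters only modulo \<open>N\<close>; hence the integer difference, possibly
  negative.\<close>

lemma tf_basis_mult_alltop:
  assumes "k < N"
  shows "(tf_basis N i *\<^sub>v alltop N) $ k =
    chi N (int (i mod N) * int k + (int k - int (i div N)) ^ 3) / of_real (sqrt (real N))"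
proof -
  define q where "q = i div N"
  \<comment> \<open>The one index that the delay by \<open>q\<close> moves to
    \<open>k\<close>.\<close>
  define c where "c = nat ((int k - int q) mod int N)"
  have "N > 0" using assms by simp
  then have c: "c < N" "int c = (int k - int q) mod int N"
    by (auto simp: c_def nat_less_iff)
  have c_iff: "k = (b + q) mod N \<longleftrightarrow> b = c" if "b < N" for b
  proof -
    have "k = (b + q) mod N \<longleftrightarrow> int k mod int N = (int b + int q) mod int N"
      using assms by (metis mod_less of_nat_add of_nat_eq_iff of_nat_mod)
    also have "\<dots> \<longleftrightarrow> (int k - int q) mod int N = int b mod int N"
      by (simp add: mod_eq_dvd_iff algebra_simps)
    finally show ?thesis using that c by auto
  qed
  have "(tf_basis N i *\<^sub>v alltop N) $ k =
      (\<Sum>b<N. chi N (int (i mod N) * int k) * (if b = c then 1 else 0) * alltop N $ b)"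
    using assms
    by (auto simp: tf_basis_def shift_mat_pow modulation_mat_pow mat_diag_mult_left[of _ N N]
        scalar_prod_def lessThan_atLeast0 c_iff q_def[symmetric] dim_vec_alltop intro!: sum.cong)
  also have "\<dots> = (\<Sum>b<N. if b = c then chi N (int (i mod N) * int k) * alltop N $ b else 0)"
    by (intro sum.cong) auto
  also have "\<dots> = chi N (int (i mod N) * int k) * (chi N (int c ^ 3) / of_real (sqrt (real N)))"
    using c(1) by (simp add: alltop_index)
  also have "chi N (int c ^ 3) = chi N ((int k - int q) ^ 3)"
    by (rule chi_cong) (use \<open>N > 0\<close> c in \<open>simp_all add: mod_eq_dvd_iff[symmetric] power_mod\<close>)
  finally show ?thesis
    by (simp add: chi_add q_def)
qed

section \<open>The dictionary as a linear system, and its coherence\<close>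

lemma dictionary_carrier: "dictionary N \<in> carrier_mat N (N\<^sup>2)"
  by (simp add: dictionary_def carrier_matI)

lemma tf_basis_mult_alltop_carrier: "tf_basis N i *\<^sub>v alltop N \<in> carrier_vec N"
  by (rule carrier_vecI) (simp add: carrier_matD(1)[OF tf_basis_carrier])

lemma col_dictionary:
  assumes "i < N\<^sup>2"
  shows "col (dictionary N) i = tf_basis N i *\<^sub>v alltop N"
proof -
  let ?cols = "map (\<lambda>i. tf_basis N i *\<^sub>v alltop N) [0..<N\<^sup>2]"
  have len: "i < length ?cols" and nth: "?cols ! i = tf_basis N i *\<^sub>v alltop N"
    using assms by simp_all
  show ?thesis
    using col_mat_of_cols[of i ?cols N, unfolded nth, OF len tf_basis_mult_alltop_carrier]
    by (simp only: dictionary_def)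
qed

lemma tf_matrix_mult_alltop:
  assumes "s \<in> carrier_vec (N\<^sup>2)"
  shows "tf_matrix N s *\<^sub>v alltop N = dictionary N *\<^sub>v s"
proof (rule eq_vecI)
  fix a
  assume "a < dim_vec (dictionary N *\<^sub>v s)"
  then have a: "a < N" by (simp add: dictionary_def)
  have "(tf_matrix N s *\<^sub>v alltop N) $ a =
      (\<Sum>b<N. \<Sum>i<N\<^sup>2. s $ i * (tf_basis N i $$ (a, b) * alltop N $ b))"
    using a carrier_matD[OF tf_basis_carrier, of N]
    by (auto simp: tf_matrix_def scalar_prod_def lessThan_atLeast0 dim_vec_alltop sum_distrib_left sum_distrib_right mult_ac
        intro!: sum.cong)
  also have "\<dots> = (\<Sum>i<N\<^sup>2. s $ i * (tf_basis N i *\<^sub>v alltop N) $ a)"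
    using a carrier_matD[OF tf_basis_carrier, of N]
    by (subst sum.swap)
      (auto simp: scalar_prod_def lessThan_atLeast0 dim_vec_alltop sum_distrib_left intro!: sum.cong)
  also have "\<dots> = (\<Sum>i<N\<^sup>2. dictionary N $$ (a, i) * s $ i)"
    using a dictionary_carrier[of N]
    by (intro sum.cong) (auto simp: mult.commute simp flip: col_dictionary)
  also have "\<dots> = (dictionary N *\<^sub>v s) $ a"
    using a assms dictionary_carrier[of N]
    by (auto simp: scalar_prod_def lessThan_atLeast0 intro!: sum.cong)
  finally show "(tf_matrix N s *\<^sub>v alltop N) $ a = (dictionary N *\<^sub>v s) $ a" .
qed (simp add: tf_matrix_def dictionary_def)


text \<open>Expansion of the difference of two shifted cubes, in which the cube of \<open>k\<close>
  cancels; the modulations only affect the linear coefficient. The divisor is the product of the two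
  factors \<open>sqrt N\<close>.\<close>

lemma dictionary_cscalar_prod:
  assumes "i < N\<^sup>2" "j < N\<^sup>2"
  shows "col (dictionary N) i \<bullet>c col (dictionary N) j =
    (\<Sum>k<N. chi N (3 * (int (j div N) - int (i div N)) * (int k)\<^sup>2 +
      (int (i mod N) - int (j mod N) + 3 * ((int (i div N))\<^sup>2 - (int (j div N))\<^sup>2)) * int k +
      (int (j div N) ^ 3 - int (i div N) ^ 3))) / of_nat N"
proof -
  have sq: "complex_of_real (sqrt (real N)) * of_real (sqrt (real N)) = of_nat N"
    by (simp flip: of_real_mult)
  have "col (dictionary N) i \<bullet>c col (dictionary N) j =
    (\<Sum>k<N. (tf_basis N i *\<^sub>v alltop N) $ k * cnj ((tf_basis N j *\<^sub>v alltop N) $ k))"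
    using assms tf_basis_carrier[of N j]
    by (simp add: col_dictionary cscalar_prod_sum[of _ N] mult_mat_vec_carrier carrier_vecI)
  also have "\<dots> = (\<Sum>k<N. chi N (3 * (int (j div N) - int (i div N)) * (int k)\<^sup>2 +
      (int (i mod N) - int (j mod N) + 3 * ((int (i div N))\<^sup>2 - (int (j div N))\<^sup>2)) * int k +
      (int (j div N) ^ 3 - int (i div N) ^ 3)) / of_nat N)"
    by (intro sum.cong refl)
      (simp add: tf_basis_mult_alltop cnj_chi sq chi_add[symmetric] algebra_simps
        power2_eq_square power3_eq_cube del: of_nat_mod of_nat_div)
  finally show ?thesis by (simp add: sum_divide_distrib)
qed

lemma dictionary_unit_col:
  assumes "i < N\<^sup>2"
  shows "col (dictionary N) i \<bullet>c col (dictionary N) i = 1"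
  using assms by (subst dictionary_cscalar_prod) (auto intro: Nat.gr0I)

lemma dictionary_coherence:
  assumes "prime N" "N \<ge> 5" "i < N\<^sup>2" "j < N\<^sup>2" "i \<noteq> j"
  shows "cmod (col (dictionary N) i \<bullet>c col (dictionary N) j) \<le> 1 / sqrt (real N)"
proof (cases "i div N = j div N")
  case True
  have "N > 0" using assms by simp
  \<comment> \<open>Quotient and remainder determine the index, so equal delays force different
    modulations.\<close>
  have "i mod N \<noteq> j mod N"
    using True assms(5) div_mult_mod_eq[of i N] div_mult_mod_eq[of j N] by auto
  moreover have "\<bar>int (i mod N) - int (j mod N)\<bar> < int N"
    using \<open>N > 0\<close> mod_less_divisor[of N i] mod_less_divisor[of N j] by linarith
  ultimately have "\<not> int N dvd int (i mod N) - int (j mod N)"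
    using zdvd_not_zless[of "\<bar>int (i mod N) - int (j mod N)\<bar>" "int N"] by simp
  then have "col (dictionary N) i \<bullet>c col (dictionary N) j = 0"
    using assms True sum_chi_linear[OF \<open>N > 0\<close>, of "int (i mod N) - int (j mod N)"]
    by (simp add: dictionary_cscalar_prod del: of_nat_mod)
  then show ?thesis by simp
next
  case False
  have "N > 0" using assms by simp
  have lt: "i div N < N" "j div N < N"
    using assms by (simp_all add: less_mult_imp_div_less power2_eq_square)
  have "\<not> int N dvd int (j div N) - int (i div N)"
    using zdvd_not_zless[of "\<bar>int (j div N) - int (i div N)\<bar>" "int N"] lt False by simp
  \<comment> \<open>The 6 is the 3 from expanding the cubes times the 2 of the Gauss sum condition;
    here \<open>N \<ge> 5\<close> enters.\<close>
  moreover have "\<not> N dvd 6"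
  proof
    assume "N dvd 6"
    then have "N dvd 2 * 3" by simp
    then have "N dvd 2 \<or> N dvd 3" using assms(1) by (simp only: prime_dvd_mult_iff)
    then have "N \<le> 3" by (auto dest: dvd_imp_le)
    then show False using assms(2) by simp
  qed
  then have "\<not> int N dvd 6" by (metis int_dvd_int_iff of_nat_numeral)
  moreover have "prime (int N)" using assms(1) by simp
  ultimately have "\<not> int N dvd 6 * (int (j div N) - int (i div N))"
    using \<open>prime (int N)\<close> by (simp only: prime_dvd_mult_iff simp_thms)
  from prime_imp_coprime[OF \<open>prime (int N)\<close> this]
  have "coprime (2 * (3 * (int (j div N) - int (i div N)))) (int N)"
    by (simp only: coprime_commute mult.assoc[symmetric]) simp
  from norm_quadratic_gauss_sum[OF this \<open>N > 0\<close>]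
  have "cmod (col (dictionary N) i \<bullet>c col (dictionary N) j) = sqrt (real N) / real N"
    using assms by (simp add: dictionary_cscalar_prod norm_divide del: of_nat_div of_nat_mod)
  also have "\<dots> = 1 / sqrt (real N)"
    using \<open>N > 0\<close> by (simp add: field_simps)
  finally show ?thesis by simp
qed

theorem theorem1:
  fixes N K :: nat and s y :: "complex vec" and H :: "complex mat"
  assumes "prime N" and "N \<ge> 5"
    and "s \<in> carrier_vec (N\<^sup>2)"
    and "H = tf_matrix N s"
    and "sparse K s"
    and "real K < (sqrt (real N) + 1) / 2"
    and "y = H *\<^sub>v alltop N"
  shows "(\<forall>s'. bp_solution (dictionary N) y s' \<longleftrightarrow> s' = s) \<and>
         (\<forall>s'. omp_output (dictionary N) y K s' \<longleftrightarrow> s' = s)"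
proof -
  interpret incoherent_dictionary "dictionary N" N "N\<^sup>2" "1 / sqrt (real N)"
    using assms(1,2) by unfold_locales
      (auto simp: dictionary_carrier dictionary_unit_col dictionary_coherence)
  define S where "S = {i. i < N\<^sup>2 \<and> s $ i \<noteq> 0}"
  have S: "S \<subseteq> {..<N\<^sup>2}" "supported_on S s" "card S \<le> K"
    using assms(3,5) by (auto simp: S_def supported_on_def sparse_def)
  \<comment> \<open>The sparsity hypothesis multiplied by \<open>2 / sqrt N\<close>.\<close>
  have K: "2 * real K * (1 / sqrt (real N)) < 1 + 1 / sqrt (real N)"
    using assms(2,6) by (simp add: field_simps)
  have "2 * real (card S) * (1 / sqrt (real N)) \<le> 2 * real K * (1 / sqrt (real N))"
    using S(3) by (intro mult_right_mono) auto
  then have "2 * real (card S) * (1 / sqrt (real N)) < 1 + 1 / sqrt (real N)"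
    using K by linarith
  moreover have "y = dictionary N *\<^sub>v s"
    using assms(3,4,7) by (simp add: tf_matrix_mult_alltop)
  ultimately show ?thesis
    using bp_solution_iff omp_output_iff S K assms(3) by blast
qed

end
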